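(* Let $J\ge 3$. The two subfamilies of models $\{(\text{cumulative},\text{exponential},Z);\ Z\in\mathfrak{Z}\}$ and $\{(\text{sequential},\text{exponential},Z);\ Z\in\mathfrak{Z}\}$ are equal (as sets of models, where equal models are identified).
   Context: Setting. Let $J\ge 3$ (number of categories), $p\ge 1$, and let $\mathcal{X}\subseteq\mathbb{R}^p$ be the nonempty set of values of the explanatory vector $x$. Let $\mathcal{M}=\{\pi\in\,]0,1[^{J-1} : \sum_{j=1}^{J-1}\pi_j<1\}$; for $\pi\in\mathcal{M}$ put $\pi_J=1-\sum_{j=1}^{J-1}\pi_j$ ($\pi_j$ is the probability of category $j$). Ratios. The cumulative ratio $r:\mathcal{M}\to\,]0,1[^{J-1}$ is $r_j(\pi)=\pi_1+\dots+\pi_j$; the sequential ratio is $r_j(\pi)=\pi_j/(\pi_j+\dots+\pi_J)$, for $j=1,\dots,J-1$. Each is injective on $\mathcal{M}$. Cdf. The exponential cdf is $F(w)=1-e^{-w}$, used on the open interval $I_F=\,]0,+\infty[$, which it maps bijectively onto $]0,1[$. Design matrices. The complete design matrix $Z_c(x)$ is the $(J-1)\times(J-1)(1+p)$ matrix with $Z_c(x)\beta=(\alpha_j+x^t\delta_j)_{j=1,\dots,J-1}$ for $\beta=(\alpha_1,\dots,\alpha_{J-1},\delta_1^t,\dots,\delta_{J-1}^t)^t$, $\alpha_j\in\mathbb{R}$, $\delta_j\in\mathbb{R}^p$. The set $\mathfrak{Z}$ of design matrices consists of all matrix functions $Z:x\mapsto Z_c(x)C$, where $C$ is a constant real matrix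 of full column rank with $q$ columns, $J-1+p\le q\le (J-1)(1+p)$. Models. A model $(r,F,Z)$, with $Z$ having $q$ columns, has as parameter space the set of $\beta\in\mathbb{R}^q$ such that for all $x\in\mathcal{X}$, $\eta=Z(x)\beta$ satisfies $\eta\in I_F^{J-1}$ and $(F(\eta_1),\dots,F(\eta_{J-1}))\in r(\mathcal{M})$. For such $\beta$ and $x\in\mathcal{X}$, it defines the unique $\pi=\pi(x;\beta)\in\mathcal{M}$ with $r(\pi)=(F(\eta_1),\dots,F(\eta_{J-1}))^t$, $\eta=Z(x)\beta$. Two models are equal if they have the same parameter space and give the same $\pi(x;\beta)$ for all $x\in\mathcal{X}$ and all $\beta$ in it. Two sets of models are equal if every model of each is equal to some model of the other. *)

theory Defs
  imports "HOL-Analysis.Analysis" "Jordan_Normal_Form.DL_Rank"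
begin

(* Vectors and matrices are indexed from 0: entry j of a vector of length J - 1 belongs to
   category j + 1. *)

definition prob_simplex :: "nat \<Rightarrow> real vec set" where
  "prob_simplex J =
     {\<pi> \<in> carrier_vec (J - 1). (\<forall>j < J - 1. 0 < \<pi> $ j \<and> \<pi> $ j < 1) \<and> (\<Sum>j < J - 1. \<pi> $ j) < 1}"

(* The probabilities of all J categories; the last one is not an entry of the vector. *)
definition cat_prob :: "nat \<Rightarrow> real vec \<Rightarrow> nat \<Rightarrow> real" where
  "cat_prob J \<pi> j = (if j < J - 1 then \<pi> $ j else 1 - (\<Sum>k < J - 1. \<pi> $ k))"

definition cumulative :: "nat \<Rightarrow> real vec \<Rightarrow> real vec" where
  "cumulative J \<pi> = vec (J - 1) (\<lambda>j. \<Sum>k\<le>j. cat_prob J \<pi> k)"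

definition sequential :: "nat \<Rightarrow> real vec \<Rightarrow> real vec" where
  "sequential J \<pi> = vec (J - 1) (\<lambda>j. cat_prob J \<pi> j / (\<Sum>k = j..<J. cat_prob J \<pi> k))"

(* A cdf F comes with the open interval I_F that it maps bijectively onto ]0,1[;
   values of F outside I_F are never used. *)
type_synonym cdf = "(real \<Rightarrow> real) \<times> real set"

definition exponential :: cdf where
  "exponential = (\<lambda>w. 1 - exp (- w), {0<..})"

(* Parameters are ordered as (alpha_1, ..., alpha_(J-1), delta_1, ..., delta_(J-1)) with each
   delta_j a block of length p, so column J - 1 + j * p + l carries x_l in row j. *)
definition complete_design :: "nat \<Rightarrow> nat \<Rightarrow> real vec \<Rightarrow> real mat" where
  "complete_design J p x = mat (J - 1) ((J - 1) * (1 + p)) (\<lambda>(j, c).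
     if c < J - 1 then (if c = j then 1 else 0)
     else if (c - (J - 1)) div p = j then x $ ((c - (J - 1)) mod p) else 0)"

definition design_matrices :: "nat \<Rightarrow> nat \<Rightarrow> (real vec \<Rightarrow> real mat) set" where
  "design_matrices J p = {Z. \<exists>q C. J - 1 + p \<le> q \<and> q \<le> (J - 1) * (1 + p) \<and>
     C \<in> carrier_mat ((J - 1) * (1 + p)) q \<and> vec_space.rank ((J - 1) * (1 + p)) C = q \<and>
     Z = (\<lambda>x. complete_design J p x * C)}"

type_synonym model = "(real vec \<Rightarrow> real vec) \<times> cdf \<times> (real vec \<Rightarrow> real mat)"

(* Z x has the same number q of columns for every x, so for nonempty X the condition on dim_vec
   says that the parameter lies in R^q. *)
fun param_space :: "nat \<Rightarrow> real vec set \<Rightarrow> model \<Rightarrow> real vec set" where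
  "param_space J X (r, (F, I), Z) =
     {\<beta>. \<forall>x\<in>X. dim_vec \<beta> = dim_col (Z x) \<and>
        (\<forall>j < J - 1. (Z x *\<^sub>v \<beta>) $ j \<in> I) \<and>
        map_vec F (Z x *\<^sub>v \<beta>) \<in> r ` prob_simplex J}"

fun model_prob :: "nat \<Rightarrow> model \<Rightarrow> real vec \<Rightarrow> real vec \<Rightarrow> real vec" where
  "model_prob J (r, (F, I), Z) x \<beta> =
     (THE \<pi>. \<pi> \<in> prob_simplex J \<and> r \<pi> = map_vec F (Z x *\<^sub>v \<beta>))"

definition equal_models :: "nat \<Rightarrow> real vec set \<Rightarrow> model \<Rightarrow> model \<Rightarrow> bool" where
  "equal_models J X m m' \<longleftrightarrow>
     param_space J X m = param_space J X m' \<and>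
     (\<forall>x\<in>X. \<forall>\<beta>\<in>param_space J X m. model_prob J m x \<beta> = model_prob J m' x \<beta>)"

definition equal_model_sets :: "nat \<Rightarrow> real vec set \<Rightarrow> model set \<Rightarrow> model set \<Rightarrow> bool" where
  "equal_model_sets J X A B \<longleftrightarrow>
     (\<forall>m\<in>A. \<exists>m'\<in>B. equal_models J X m m') \<and> (\<forall>m'\<in>B. \<exists>m\<in>A. equal_models J X m' m)"

lemma complete_design_mult:
  assumes x: "x \<in> carrier_vec p" and b: "\<beta> \<in> carrier_vec ((J - 1) * (1 + p))"
  shows "complete_design J p x *\<^sub>v \<beta> =
    vec (J - 1) (\<lambda>j. \<beta> $ j + (\<Sum>l<p. x $ l * \<beta> $ (J - 1 + j * p + l)))"
proof (rule eq_vecI)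
  define m where "m = J - 1"
  fix j
  assume "j < dim_vec (vec (J - 1) (\<lambda>j. \<beta> $ j + (\<Sum>l<p. x $ l * \<beta> $ (J - 1 + j * p + l))))"
  then have j: "j < m" by (simp add: m_def)
  define h where "h = (\<lambda>c. (if c < m then (if c = j then 1 else 0)
     else if (c - m) div p = j then x $ ((c - m) mod p) else 0) * \<beta> $ c)"
  have "(complete_design J p x *\<^sub>v \<beta>) $ j = (\<Sum>c = 0..<m * (1 + p). h c)"
    using j b unfolding complete_design_def m_def h_def
    by (auto simp: scalar_prod_def intro!: sum.cong)
  also have "\<dots> = (\<Sum>c = 0..<m. h c) + (\<Sum>c = m..<m + m * p. h c)"
    by (simp add: sum.atLeastLessThan_concat)
  also have "(\<Sum>c = 0..<m. h c) = (\<Sum>c = 0..<m. if c = j then \<beta> $ j else 0)"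
    by (rule sum.cong) (auto simp: h_def)
  also have "\<dots> = \<beta> $ j"
    using j by simp
  also have "(\<Sum>c = m..<m + m * p. h c) = (\<Sum>l<p. x $ l * \<beta> $ (m + j * p + l))"
  proof (rule sum.mono_neutral_cong_right[THEN trans])
    show "finite {m..<m + m * p}" by simp
    have "j * p + p \<le> m * p"
      using mult_le_mono1[of "Suc j" m p] j by simp
    then show "(\<lambda>l. m + j * p + l) ` {..<p} \<subseteq> {m..<m + m * p}"
      by auto
    show "\<forall>c\<in>{m..<m + m * p} - (\<lambda>l. m + j * p + l) ` {..<p}. h c = 0"
    proof
      fix c assume c: "c \<in> {m..<m + m * p} - (\<lambda>l. m + j * p + l) ` {..<p}"
      have p0: "0 < p" using c by (cases p) auto
      have "(c - m) div p \<noteq> j"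
      proof
        assume "(c - m) div p = j"
        then have "c - m = j * p + (c - m) mod p" by (metis div_mult_mod_eq)
        then have "c = m + j * p + (c - m) mod p" using c by auto
        moreover have "(c - m) mod p < p" using p0 by simp
        ultimately show False using c by blast
      qed
      then show "h c = 0" using c by (simp add: h_def)
    qed
    show "\<And>c. c \<in> (\<lambda>l. m + j * p + l) ` {..<p} \<Longrightarrow> h c = h c" by simp
    have "sum h ((\<lambda>l. m + j * p + l) ` {..<p}) = (\<Sum>l<p. h (m + j * p + l))"
      by (subst sum.reindex) (auto simp: inj_on_def)
    also have "\<dots> = (\<Sum>l<p. x $ l * \<beta> $ (m + j * p + l))"
      by (rule sum.cong) (auto simp: h_def)
    finally show "sum h ((\<lambda>l. m + j * p + l) ` {..<p}) = (\<Sum>l<p. x $ l * \<beta> $ (m + j * p + l))" .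
  qed
  finally show "(complete_design J p x *\<^sub>v \<beta>) $ j =
    vec (J - 1) (\<lambda>j. \<beta> $ j + (\<Sum>l<p. x $ l * \<beta> $ (J - 1 + j * p + l))) $ j"
    using j by (simp add: m_def)
qed (simp add: complete_design_def)

lemma inj_on_cumulative: "inj_on (cumulative J) (prob_simplex J)"
proof (rule inj_onI)
  fix a b :: "real vec"
  assume a: "a \<in> prob_simplex J" and b: "b \<in> prob_simplex J"
    and eq: "cumulative J a = cumulative J b"
  have s: "(\<Sum>k\<le>j. a $ k) = (\<Sum>k\<le>j. b $ k)" if "j < J - 1" for j
  proof -
    have "cumulative J a $ j = cumulative J b $ j" using eq by simp
    moreover have "cumulative J v $ j = (\<Sum>k\<le>j. v $ k)" for v
      using that by (auto simp: cumulative_def cat_prob_def intro!: sum.cong)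
    ultimately show ?thesis by simp
  qed
  have "a $ j = b $ j" if "j < J - 1" for j
    using s[OF that] s[of "j - 1"] that by (cases j) auto
  then show "a = b"
    using a b by (auto simp: prob_simplex_def)
qed

lemma inj_on_sequential: "inj_on (sequential J) (prob_simplex J)"
proof (rule inj_onI)
  fix a b :: "real vec"
  assume a: "a \<in> prob_simplex J" and b: "b \<in> prob_simplex J"
    and eq: "sequential J a = sequential J b"
  define S where "S v j = (\<Sum>k = j..<J. cat_prob J v k)" for v j
  have pos: "0 < cat_prob J v k" if "v \<in> prob_simplex J" for v k
    using that by (auto simp: prob_simplex_def cat_prob_def)
  have S_pos: "0 < S v j" if "v \<in> prob_simplex J" "j < J - 1" for v j
    unfolding S_def using that by (intro sum_pos pos) auto
  have S_Suc: "S v j = cat_prob J v j + S v (Suc j)" if "j < J - 1" for v j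
    unfolding S_def using that by (simp add: sum.atLeast_Suc_lessThan)
  have S0: "S v 0 = 1" if "0 < J" for v
  proof -
    obtain n where n: "J = Suc n" using \<open>0 < J\<close> by (cases J) auto
    have "(\<Sum>k = 0..<n. cat_prob J v k) = (\<Sum>k<n. v $ k)"
      by (rule sum.cong) (auto simp: cat_prob_def n)
    then show ?thesis by (simp add: S_def n cat_prob_def)
  qed
  have ratio: "cat_prob J a j / S a j = cat_prob J b j / S b j" if "j < J - 1" for j
  proof -
    have "sequential J a $ j = sequential J b $ j" using eq by simp
    then show ?thesis using that by (simp add: sequential_def S_def)
  qed
  have step: "cat_prob J a j = cat_prob J b j" if "j < J - 1" "S a j = S b j" for j
    using ratio[OF that(1)] S_pos[OF b that(1)] that(2) by simp
  have S_eq: "j < J - 1 \<Longrightarrow> S a j = S b j" for j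
  proof (induction j)
    case 0
    then show ?case using S0 by simp
  next
    case (Suc j)
    then have "j < J - 1" "S a j = S b j" by auto
    then show ?case using step[of j] S_Suc[of j a] S_Suc[of j b] by simp
  qed
  have "a $ j = b $ j" if "j < J - 1" for j
    using step[OF that S_eq[OF that]] that by (simp add: cat_prob_def)
  then show "a = b"
    using a b by (auto simp: prob_simplex_def)
qed

end

theory Submission
  imports Defs
begin

text \<open>Writing \<open>S\<^sub>j\<close> for the probability of the categories after \<open>j\<close>, the exponential cumulative model says
  \<open>S\<^sub>j = exp (- \<eta>\<^sub>j)\<close> and the exponential sequential model says \<open>S\<^sub>j / S\<^sub>j\<^sub>-\<^sub>1 = exp (- \<eta>'\<^sub>j)\<close>. Hence they
  give the same probabilities if and only if \<open>\<eta>\<^sub>j = \<eta>'\<^sub>1 + \<dots> + \<eta>'\<^sub>j\<close>. Taking partial sums of the rows of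
  the complete design matrix amounts to multiplying it on the right by a constant lower unitriangular
  matrix, so both directions only replace \<open>C\<close> by its product with an invertible matrix.\<close>

section \<open>Full column rank\<close>

text \<open>Independence concerns the set of columns, so it matches a trivial kernel only if no
  column is repeated. Each direction first excludes repetitions: by counting columns, respectively
  because two equal columns put a difference of unit vectors into the kernel.\<close>

lemma (in vec_space) full_column_rank_iff:
  assumes A: "A \<in> carrier_mat n nc"
  shows "rank A = nc \<longleftrightarrow> (\<forall>v \<in> carrier_vec nc. A *\<^sub>v v = 0\<^sub>v n \<longrightarrow> v = 0\<^sub>v nc)"
proof
  assume r: "rank A = nc"
  have "distinct (cols A)"
  proof (rule ccontr)
    assume nd: "\<not> distinct (cols A)"
    \<comment> \<open>The rank is the size of a maximal independent set of columns, hence at most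
      the number of distinct columns.\<close>
    obtain S where S: "maximal S (\<lambda>T. T \<subseteq> set (cols A) \<and> lin_indpt T)"
      using maximal_exists_superset[of "set (cols A)" "\<lambda>T. T \<subseteq> set (cols A) \<and> lin_indpt T" "{}"]
      by (metis List.finite_set empty_subsetI finite_lin_indpt2 empty_iff finite.emptyI)
    then have "card S \<le> card (set (cols A))"
      by (simp add: card_mono maximal_def)
    also have "\<dots> < nc"
      using nd A card_length[of "cols A"] card_distinct[of "cols A"] by fastforce
    finally show False
      using rank_card_indpt[OF A S] r by simp
  qed
  then show "\<forall>v \<in> carrier_vec nc. A *\<^sub>v v = 0\<^sub>v n \<longrightarrow> v = 0\<^sub>v nc"
    using lin_depI[OF A] full_rank_lin_indpt[OF A r] by blast
next
  assume inj: "\<forall>v \<in> carrier_vec nc. A *\<^sub>v v = 0\<^sub>v n \<longrightarrow> v = 0\<^sub>v nc"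
  have d: "distinct (cols A)"
  proof (rule ccontr)
    assume "\<not> distinct (cols A)"
    then obtain i j where ij: "i < nc" "j < nc" "i \<noteq> j" "col A i = col A j"
      using A by (auto simp: distinct_conv_nth)
    have unit: "A *\<^sub>v unit_vec nc k = col A k" if "k < nc" for k
      using A that by (intro eq_vecI) auto
    let ?v = "unit_vec nc i - unit_vec nc j :: 'a vec"
    have "A *\<^sub>v ?v = 0\<^sub>v n"
      using A ij mult_minus_distrib_mat_vec[OF A, of "unit_vec nc i" "unit_vec nc j"]
      by (simp add: unit)
    then have "?v = 0\<^sub>v nc"
      using inj by simp
    then have "?v $ i = 0"
      using ij by simp
    then show False
      using ij by simp
  qed
  then show "rank A = nc"
    using lin_indpt_full_rank[OF A d] lin_depE[OF A _ d] inj by metis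
qed

text \<open>The left inverse \<open>Q\<close> recovers \<open>A *\<^sub>v v\<close> from
  \<open>(P * A) *\<^sub>v v\<close>, so the kernel stays trivial.\<close>

lemma (in vec_space) full_column_rank_mult_left:
  assumes A: "A \<in> carrier_mat n nc" and r: "rank A = nc"
    and P: "P \<in> carrier_mat n n" and Q: "Q \<in> carrier_mat n n" and QP: "Q * P = 1\<^sub>m n"
  shows "rank (P * A) = nc"
proof -
  have PA: "P * A \<in> carrier_mat n nc"
    using A P by simp
  have "v = 0\<^sub>v nc" if v: "v \<in> carrier_vec nc" and 0: "(P * A) *\<^sub>v v = 0\<^sub>v n" for v
  proof -
    have Av: "A *\<^sub>v v \<in> carrier_vec n"
      using A v by simp
    have "A *\<^sub>v v = (Q * P) *\<^sub>v (A *\<^sub>v v)"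
      using Av by (simp add: QP)
    also have "\<dots> = Q *\<^sub>v ((P * A) *\<^sub>v v)"
      by (simp add: assoc_mult_mat_vec[OF Q P Av] assoc_mult_mat_vec[OF P A v])
    also have "\<dots> = 0\<^sub>v n"
      using Q 0 by (auto intro!: eq_vecI simp: scalar_prod_def)
    finally show ?thesis
      using r v full_column_rank_iff[OF A] by blast
  qed
  then show ?thesis
    using full_column_rank_iff[OF PA] by blast
qed

section \<open>Partial sums of the linear predictors\<close>

text \<open>The parameters summed in position \<open>c\<close> are those for the same coefficient (the intercept, or one
  coordinate of the slope) of all rows up to the row of \<open>c\<close>; here \<open>m = J - 1\<close>.\<close>

definition partial_sum_index :: "nat \<Rightarrow> nat \<Rightarrow> nat \<Rightarrow> nat set" where
  "partial_sum_index m p c =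
     (if c < m then {..c} else (\<lambda>k. m + k * p + (c - m) mod p) ` {..(c - m) div p})"

definition partial_sum_mat :: "nat \<Rightarrow> nat \<Rightarrow> real mat" where
  "partial_sum_mat m p = mat (m * (1 + p)) (m * (1 + p))
     (\<lambda>(c, d). if d \<in> partial_sum_index m p c then 1 else 0)"

lemma partial_sum_mat_carrier [simp]:
  "partial_sum_mat m p \<in> carrier_mat (m * (1 + p)) (m * (1 + p))"
  by (simp add: partial_sum_mat_def)

text \<open>With \<open>partial_sum_index_self\<close>, this makes \<open>partial_sum_mat\<close>
  lower triangular with unit diagonal.\<close>

lemma partial_sum_index_le: "d \<in> partial_sum_index m p c \<Longrightarrow> d \<le> c"
proof -
  have "m + k * p + (c - m) mod p \<le> c" if "\<not> c < m" "k \<le> (c - m) div p" for k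
  proof -
    have "k * p + (c - m) mod p \<le> (c - m) div p * p + (c - m) mod p"
      by (intro add_right_mono mult_le_mono1 that(2))
    then show ?thesis
      using that(1) div_mult_mod_eq[of "c - m" p] by linarith
  qed
  then show "d \<in> partial_sum_index m p c \<Longrightarrow> d \<le> c"
    by (auto simp: partial_sum_index_def split: if_splits)
qed

lemma partial_sum_index_self: "c \<in> partial_sum_index m p c"
proof (cases "c < m")
  case False
  then have "c = m + (c - m) div p * p + (c - m) mod p"
    by (metis add.assoc div_mult_mod_eq le_add_diff_inverse not_less)
  then have "c \<in> (\<lambda>k. m + k * p + (c - m) mod p) ` {..(c - m) div p}"
    by (rule image_eqI) simp
  then show ?thesis
    using False by (simp add: partial_sum_index_def)
qed (simp add: partial_sum_index_def)

lemma partial_sum_mat_mult_vec: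
  assumes v: "v \<in> carrier_vec (m * (1 + p))" and c: "c < m * (1 + p)"
  shows "(partial_sum_mat m p *\<^sub>v v) $ c = (\<Sum>d\<in>partial_sum_index m p c. v $ d)"
proof -
  let ?N = "m * (1 + p)"
  have "(partial_sum_mat m p *\<^sub>v v) $ c =
      (\<Sum>d = 0..<?N. if d \<in> partial_sum_index m p c then v $ d else 0)"
    using v c unfolding partial_sum_mat_def by (auto simp: scalar_prod_def intro!: sum.cong)
  also have "\<dots> = (\<Sum>d\<in>partial_sum_index m p c. v $ d)"
    using partial_sum_index_le[of _ m p c] c by (intro sum.mono_neutral_cong_right) fastforce+
  finally show ?thesis .
qed

text \<open>The determinant of a triangular matrix is the product of its diagonal entries, here all
  1.\<close>

lemma partial_sum_mat_inverse:
  obtains N where "N \<in> carrier_mat (m * (1 + p)) (m * (1 + p))"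
    "N * partial_sum_mat m p = 1\<^sub>m (m * (1 + p))" "partial_sum_mat m p * N = 1\<^sub>m (m * (1 + p))"
proof -
  have "diag_mat (partial_sum_mat m p) = map (\<lambda>_. 1) [0..<m * (1 + p)]"
    by (auto simp: diag_mat_def partial_sum_mat_def partial_sum_index_self)
  moreover have "det (partial_sum_mat m p) = prod_list (diag_mat (partial_sum_mat m p))"
    by (rule det_lower_triangular[OF _ partial_sum_mat_carrier])
      (auto simp: partial_sum_mat_def dest: partial_sum_index_le)
  ultimately have "det (partial_sum_mat m p) \<noteq> 0"
    by (auto simp: prod_list_zero_iff)
  \<comment> \<open>The \<open>()\<close> only fills the extension field of the record
    \<open>ring_mat\<close>.\<close>
  from det_non_zero_imp_unit[OF partial_sum_mat_carrier this, of "()"] show ?thesis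
    by (auto simp: Units_def ring_mat_def intro: that)
qed

text \<open>Row \<open>j\<close> of the complete design reads only the intercept and the slope block
  of row \<open>j\<close>. The matrix replaces these by their sums over the rows up to
  \<open>j\<close>, and the predictor is linear in them with the same \<open>x\<close> in every
  row.\<close>

lemma complete_design_partial_sum_mat:
  assumes x: "x \<in> carrier_vec p" and v: "v \<in> carrier_vec ((J - 1) * (1 + p))" and j: "j < J - 1"
  shows "(complete_design J p x *\<^sub>v (partial_sum_mat (J - 1) p *\<^sub>v v)) $ j =
    (\<Sum>k\<le>j. (complete_design J p x *\<^sub>v v) $ k)"
proof -
  define m where "m = J - 1"
  let ?Mv = "partial_sum_mat m p *\<^sub>v v"
  note v' = v[folded m_def] and j' = j[folded m_def]
  have block: "m + j * p + l < m * (1 + p)" if "l < p" for l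
    using mult_le_mono1[of "Suc j" m p] j' that by simp
  have "?Mv $ j = (\<Sum>k\<le>j. v $ k)"
    using j' by (subst partial_sum_mat_mult_vec[OF v']) (auto simp: partial_sum_index_def)
  moreover have "?Mv $ (m + j * p + l) = (\<Sum>k\<le>j. v $ (m + k * p + l))" if l: "l < p" for l
  proof -
    have "partial_sum_index m p (m + j * p + l) = (\<lambda>k. m + k * p + l) ` {..j}"
      using l by (simp add: partial_sum_index_def add.assoc)
    \<comment> \<open>The bound \<open>l < p\<close> makes \<open>p\<close> positive, so different
      rows give different indices.\<close>
    moreover have "inj_on (\<lambda>k. m + k * p + l) {..j}"
      using l by (auto simp: inj_on_def)
    ultimately show ?thesis
      by (simp add: partial_sum_mat_mult_vec[OF v' block[OF l]] sum.reindex)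
  qed
  moreover have "?Mv \<in> carrier_vec (m * (1 + p))"
    using partial_sum_mat_carrier v' by (rule mult_mat_vec_carrier)
  ultimately have "(complete_design J p x *\<^sub>v ?Mv) $ j =
      (\<Sum>k\<le>j. v $ k) + (\<Sum>l<p. \<Sum>k\<le>j. x $ l * v $ (m + k * p + l))"
    using j by (simp add: complete_design_mult[OF x] m_def sum_distrib_left)
  also have "\<dots> = (\<Sum>k\<le>j. v $ k + (\<Sum>l<p. x $ l * v $ (m + k * p + l)))"
    by (subst sum.swap) (simp add: sum.distrib)
  also have "\<dots> = (\<Sum>k\<le>j. (complete_design J p x *\<^sub>v v) $ k)"
    using j by (intro sum.cong) (auto simp: complete_design_mult[OF x v] m_def)
  finally show ?thesis
    by (simp add: m_def)
qed

section \<open>Ratios and survival probabilities\<close>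

text \<open>This is \<open>S\<^sub>j\<close> with categories numbered from 1. As vector entries are
  numbered from 0, entry \<open>j\<close> of a ratio involves
  \<open>survival J \<pi> (Suc j)\<close>.\<close>

definition survival :: "nat \<Rightarrow> real vec \<Rightarrow> nat \<Rightarrow> real" where
  "survival J \<pi> j = (\<Sum>k = j..<J. cat_prob J \<pi> k)"

lemma cat_prob_pos: "\<pi> \<in> prob_simplex J \<Longrightarrow> 0 < cat_prob J \<pi> k"
  by (auto simp: prob_simplex_def cat_prob_def)

lemma survival_pos: "\<pi> \<in> prob_simplex J \<Longrightarrow> j < J \<Longrightarrow> 0 < survival J \<pi> j"
  unfolding survival_def by (intro sum_pos cat_prob_pos) auto

lemma survival_Suc: "j < J \<Longrightarrow> survival J \<pi> j = cat_prob J \<pi> j + survival J \<pi> (Suc j)"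
  by (simp add: survival_def sum.atLeast_Suc_lessThan)

text \<open>\<open>cat_prob\<close> makes the last category the complement of the others, so the
  total is 1 for any vector.\<close>

lemma survival_0:
  assumes "0 < J"
  shows "survival J \<pi> 0 = 1"
proof -
  obtain n where n: "J = Suc n"
    using assms by (cases J) auto
  have "(\<Sum>k = 0..<n. cat_prob J \<pi> k) = (\<Sum>k<n. \<pi> $ k)"
    by (rule sum.cong) (auto simp: cat_prob_def n)
  then show ?thesis
    by (simp add: survival_def n cat_prob_def)
qed

lemma cumulative_survival:
  assumes "j < J - 1"
  shows "cumulative J \<pi> $ j = 1 - survival J \<pi> (Suc j)"
proof -
  have "(\<Sum>k\<le>j. cat_prob J \<pi> k) + survival J \<pi> (Suc j) = survival J \<pi> 0"
    using assms
      sum.atLeastLessThan_concat[of 0 "Suc j" J "cat_prob J \<pi>"]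
    by (simp add: survival_def lessThan_Suc_atMost atLeast0LessThan)
  then show ?thesis
    using assms survival_0[of J \<pi>] by (simp add: cumulative_def)
qed

lemma sequential_survival:
  assumes "\<pi> \<in> prob_simplex J" "j < J - 1"
  shows "sequential J \<pi> $ j = 1 - survival J \<pi> (Suc j) / survival J \<pi> j"
proof -
  have j: "j < J"
    using assms(2) by simp
  have "survival J \<pi> j = cat_prob J \<pi> j + survival J \<pi> (Suc j)" "survival J \<pi> j \<noteq> 0"
    using j survival_pos[OF assms(1) j] survival_Suc[OF j, of \<pi>] by simp_all
  moreover have "sequential J \<pi> $ j = cat_prob J \<pi> j / survival J \<pi> j"
    using assms by (simp add: sequential_def survival_def)
  ultimately show ?thesis
    by (simp add: divide_simps)
qed

lemma cumulative_pos:
  assumes "\<pi> \<in> prob_simplex J" "j < J - 1"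
  shows "0 < cumulative J \<pi> $ j"
  using assms by (auto simp: cumulative_def intro!: sum_pos cat_prob_pos)

lemma sequential_pos:
  assumes "\<pi> \<in> prob_simplex J" "j < J - 1"
  shows "0 < sequential J \<pi> $ j"
  using assms survival_pos[of \<pi> J j]
  by (auto simp: sequential_def cat_prob_pos simp flip: survival_def)

lemma cumulative_exponential_iff_sequential:
  fixes \<pi> \<eta> \<eta>' :: "real vec"
  assumes \<pi>: "\<pi> \<in> prob_simplex J"
    and dim: "dim_vec \<eta> = J - 1" "dim_vec \<eta>' = J - 1"
    and sums: "\<And>j. j < J - 1 \<Longrightarrow> \<eta> $ j = (\<Sum>k\<le>j. \<eta>' $ k)"
  shows "cumulative J \<pi> = map_vec (\<lambda>w. 1 - exp (- w)) \<eta> \<longleftrightarrow>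
    sequential J \<pi> = map_vec (\<lambda>w. 1 - exp (- w)) \<eta>'"
proof -
  let ?S = "survival J \<pi>"
  have cum: "cumulative J \<pi> = map_vec (\<lambda>w. 1 - exp (- w)) \<eta> \<longleftrightarrow>
      (\<forall>j < J - 1. ?S (Suc j) = exp (- \<eta> $ j))"
    using dim by (auto simp: Matrix.vec_eq_iff cumulative_survival) (simp add: cumulative_def)
  have "dim_vec (sequential J \<pi>) = J - 1"
    by (simp add: sequential_def)
  \<comment> \<open>Clearing the positive denominator turns the sequential equation into a recursion
    for \<open>?S\<close>.\<close>
  moreover have "1 - ?S (Suc j) / ?S j = 1 - exp (- w) \<longleftrightarrow> ?S (Suc j) = ?S j * exp (- w)"
    if "j < J - 1" for j w
  proof -
    have "0 < ?S j"
      using survival_pos[OF \<pi>] that by simp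
    then show ?thesis
      by (auto simp: field_simps)
  qed
  ultimately have seq: "sequential J \<pi> = map_vec (\<lambda>w. 1 - exp (- w)) \<eta>' \<longleftrightarrow>
      (\<forall>j < J - 1. ?S (Suc j) = ?S j * exp (- \<eta>' $ j))"
    using dim by (simp add: Matrix.vec_eq_iff sequential_survival[OF \<pi>])
  \<comment> \<open>Consecutive partial sums differ by one entry of \<eta>', which contributes one
    exponential factor.\<close>
  have exp_Suc: "exp (- \<eta> $ Suc j) = exp (- \<eta> $ j) * exp (- \<eta>' $ Suc j)" if "Suc j < J - 1" for j
    using sums[of "Suc j"] sums[of j] that by (simp flip: exp_add)
  have exp_0: "?S 0 = 1" "\<eta> $ 0 = \<eta>' $ 0" if "0 < J - 1"
    using that survival_0[of J \<pi>] sums[of 0] by auto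
  \<comment> \<open>Forwards, \<open>?S j\<close> and \<open>?S (Suc j)\<close> are both explicit,
    so a case split suffices. Backwards, the recursion is solved by induction from
    \<open>?S 0 = 1\<close>.\<close>
  have "(\<forall>j < J - 1. ?S (Suc j) = exp (- \<eta> $ j)) \<longleftrightarrow>
      (\<forall>j < J - 1. ?S (Suc j) = ?S j * exp (- \<eta>' $ j))"
  proof (intro iffI allI impI)
    fix j
    assume "\<forall>j < J - 1. ?S (Suc j) = exp (- \<eta> $ j)" and "j < J - 1"
    then show "?S (Suc j) = ?S j * exp (- \<eta>' $ j)"
      using exp_0 exp_Suc by (cases j) auto
  next
    fix j
    assume "\<forall>j < J - 1. ?S (Suc j) = ?S j * exp (- \<eta>' $ j)" and "j < J - 1"
    then show "?S (Suc j) = exp (- \<eta> $ j)"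
      by (induction j) (use exp_0 exp_Suc in auto)
  qed
  then show ?thesis
    using cum seq by blast
qed

section \<open>Equality of the models\<close>

text \<open>As \<open>1 - exp (- w)\<close> is positive exactly when \<open>w\<close> is, membership
  in the image of a ratio with positive entries forces every predictor into \<open>{0<..}\<close>.
  Parameter spaces can thus be compared through these images.\<close>

lemma param_space_exponential:
  assumes pos: "\<And>\<pi> j. \<pi> \<in> prob_simplex J \<Longrightarrow> j < J - 1 \<Longrightarrow> 0 < r \<pi> $ j"
    and dim: "\<And>x. x \<in> X \<Longrightarrow> dim_row (Z x) = J - 1"
  shows "param_space J X (r, exponential, Z) = {\<beta>. \<forall>x\<in>X. dim_vec \<beta> = dim_col (Z x) \<and>
    map_vec (\<lambda>w. 1 - exp (- w)) (Z x *\<^sub>v \<beta>) \<in> r ` prob_simplex J}"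
proof -
  have "(Z x *\<^sub>v \<beta>) $ j \<in> {0<..}"
    if x: "x \<in> X" and j: "j < J - 1"
      and im: "map_vec (\<lambda>w. 1 - exp (- w)) (Z x *\<^sub>v \<beta>) \<in> r ` prob_simplex J" for x \<beta> j
  proof -
    from im obtain \<pi> where "\<pi> \<in> prob_simplex J" "r \<pi> = map_vec (\<lambda>w. 1 - exp (- w)) (Z x *\<^sub>v \<beta>)"
      by (metis imageE)
    then show ?thesis
      using pos[of \<pi> j] dim[OF x] j by simp
  qed
  then show ?thesis
    unfolding exponential_def param_space.simps by blast
qed

lemma equal_models_sym: "equal_models J X m m' \<Longrightarrow> equal_models J X m' m"
  by (simp add: equal_models_def)

text \<open>For a common \<beta>, associativity lets the partial sum matrix act on
  \<open>C *\<^sub>v \<beta>\<close>, so the cumulative predictors are the partial sums of the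
  sequential ones and the same \<pi> solves both equations.\<close>

lemma equal_models_cumulative_sequential:
  assumes X: "X \<subseteq> carrier_vec p"
    and C: "C \<in> carrier_mat ((J - 1) * (1 + p)) q"
  shows "equal_models J X
    (cumulative J, exponential, \<lambda>x. complete_design J p x * (partial_sum_mat (J - 1) p * C))
    (sequential J, exponential, \<lambda>x. complete_design J p x * C)"
proof -
  let ?M = "partial_sum_mat (J - 1) p"
  let ?Z = "\<lambda>x. complete_design J p x * (?M * C)" and ?Z' = "\<lambda>x. complete_design J p x * C"
  let ?F = "map_vec (\<lambda>w. 1 - exp (- w)) :: real vec \<Rightarrow> real vec"
  have D: "complete_design J p x \<in> carrier_mat (J - 1) ((J - 1) * (1 + p))" for x
    by (simp add: complete_design_def)
  have iff: "cumulative J \<pi> = ?F (?Z x *\<^sub>v \<beta>) \<longleftrightarrow> sequential J \<pi> = ?F (?Z' x *\<^sub>v \<beta>)"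
    if x: "x \<in> X" and \<beta>: "dim_vec \<beta> = q" and \<pi>: "\<pi> \<in> prob_simplex J" for x \<beta> \<pi>
  proof (rule cumulative_exponential_iff_sequential[OF \<pi>])
    show "dim_vec (?Z x *\<^sub>v \<beta>) = J - 1" "dim_vec (?Z' x *\<^sub>v \<beta>) = J - 1"
      by (simp_all add: complete_design_def)
    fix j
    assume j: "j < J - 1"
    have \<beta>': "\<beta> \<in> carrier_vec q"
      using \<beta> by (rule carrier_vecI)
    have C\<beta>: "C *\<^sub>v \<beta> \<in> carrier_vec ((J - 1) * (1 + p))"
      using C \<beta>' by (rule mult_mat_vec_carrier)
    have MC: "?M * C \<in> carrier_mat ((J - 1) * (1 + p)) q"
      using partial_sum_mat_carrier C by (rule mult_carrier_mat)
    have "?Z x *\<^sub>v \<beta> = complete_design J p x *\<^sub>v (?M *\<^sub>v (C *\<^sub>v \<beta>))"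
      by (simp only: assoc_mult_mat_vec[OF D MC \<beta>']
          assoc_mult_mat_vec[OF partial_sum_mat_carrier C \<beta>'])
    moreover have "?Z' x *\<^sub>v \<beta> = complete_design J p x *\<^sub>v (C *\<^sub>v \<beta>)"
      by (rule assoc_mult_mat_vec[OF D C \<beta>'])
    ultimately show "(?Z x *\<^sub>v \<beta>) $ j = (\<Sum>k\<le>j. (?Z' x *\<^sub>v \<beta>) $ k)"
      using complete_design_partial_sum_mat[OF _ C\<beta> j] x X by auto
  qed
  have image: "?F (?Z x *\<^sub>v \<beta>) \<in> cumulative J ` prob_simplex J \<longleftrightarrow>
      ?F (?Z' x *\<^sub>v \<beta>) \<in> sequential J ` prob_simplex J" if "x \<in> X" "dim_vec \<beta> = q" for x \<beta>
    unfolding image_iff using iff[OF that] by metis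
  have rows: "dim_row (?Z x) = J - 1" "dim_row (?Z' x) = J - 1" for x
    by (simp_all add: complete_design_def)
  have cols: "dim_col (?Z x) = q" "dim_col (?Z' x) = q" for x
    using C by simp_all
  have cum: "param_space J X (cumulative J, exponential, ?Z) = {\<beta>. \<forall>x\<in>X. dim_vec \<beta> = q \<and>
      ?F (?Z x *\<^sub>v \<beta>) \<in> cumulative J ` prob_simplex J}"
    using param_space_exponential[of J "cumulative J" X ?Z] cumulative_pos rows cols by simp
  have seq: "param_space J X (sequential J, exponential, ?Z') = {\<beta>. \<forall>x\<in>X. dim_vec \<beta> = q \<and>
      ?F (?Z' x *\<^sub>v \<beta>) \<in> sequential J ` prob_simplex J}"
    using param_space_exponential[of J "sequential J" X ?Z'] sequential_pos rows cols by simp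
  \<comment> \<open>Equivalent predicates have the same definite description.\<close>
  have "model_prob J (cumulative J, exponential, ?Z) x \<beta> =
      model_prob J (sequential J, exponential, ?Z') x \<beta>" if "x \<in> X" "dim_vec \<beta> = q" for x \<beta>
    unfolding exponential_def model_prob.simps
    by (rule arg_cong[where f = The]) (use iff[OF that] in blast)
  moreover have "param_space J X (cumulative J, exponential, ?Z) =
      param_space J X (sequential J, exponential, ?Z')"
    unfolding cum seq using image by blast
  ultimately show ?thesis
    unfolding equal_models_def using cum by blast
qed

text \<open>The factor \<open>P\<close> is absorbed into the constant matrix, keeping both
  \<open>q\<close> and the full column rank.\<close>

lemma design_matrices_mult_left:
  assumes q: "J - 1 + p \<le> q" "q \<le> (J - 1) * (1 + p)"
    and C: "C \<in> carrier_mat ((J - 1) * (1 + p)) q" "vec_space.rank ((J - 1) * (1 + p)) C = q"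
    and P: "P \<in> carrier_mat ((J - 1) * (1 + p)) ((J - 1) * (1 + p))"
    and Q: "Q \<in> carrier_mat ((J - 1) * (1 + p)) ((J - 1) * (1 + p))"
      "Q * P = 1\<^sub>m ((J - 1) * (1 + p))"
  shows "(\<lambda>x. complete_design J p x * (P * C)) \<in> design_matrices J p"
  unfolding design_matrices_def
  using q mult_carrier_mat[OF P C(1)] vec_space.full_column_rank_mult_left[OF C P Q] by blast

theorem corollary1:
  fixes J p :: nat and X :: "real vec set"
  assumes "J \<ge> 3" and "p \<ge> 1"
    and "X \<subseteq> carrier_vec p" and "X \<noteq> {}"
  shows "equal_model_sets J X
    {(cumulative J, exponential, Z) | Z. Z \<in> design_matrices J p}
    {(sequential J, exponential, Z) | Z. Z \<in> design_matrices J p}"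
proof -
  let ?N = "(J - 1) * (1 + p)" and ?M = "partial_sum_mat (J - 1) p"
  obtain L where L: "L \<in> carrier_mat ?N ?N" "L * ?M = 1\<^sub>m ?N" "?M * L = 1\<^sub>m ?N"
    by (rule partial_sum_mat_inverse)
  have "\<exists>Z'\<in>design_matrices J p.
      equal_models J X (cumulative J, exponential, Z) (sequential J, exponential, Z')"
    if "Z \<in> design_matrices J p" for Z
  proof -
    from that obtain q C where q: "J - 1 + p \<le> q" "q \<le> ?N"
      and C: "C \<in> carrier_mat ?N q" "vec_space.rank ?N C = q"
      and Z: "Z = (\<lambda>x. complete_design J p x * C)"
      unfolding design_matrices_def by blast
    \<comment> \<open>The sequential partner uses \<open>L * C\<close>: restoring the partial sums
      gives back the given cumulative design. The identity \<open>?M * L = 1\<^sub>m ?N\<close> also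
      shows that \<open>L\<close> preserves the rank.\<close>
    have "?M * (L * C) = C"
      using assoc_mult_mat[OF partial_sum_mat_carrier L(1) C(1)] left_mult_one_mat[OF C(1)]
      by (simp only: L(3))
    then show ?thesis
      using equal_models_cumulative_sequential[OF assms(3) mult_carrier_mat[OF L(1) C(1)]]
        design_matrices_mult_left[OF q C L(1) partial_sum_mat_carrier L(3)] Z by auto
  qed
  moreover have "\<exists>Z\<in>design_matrices J p.
      equal_models J X (sequential J, exponential, Z') (cumulative J, exponential, Z)"
    if "Z' \<in> design_matrices J p" for Z'
  proof -
    from that obtain q C where q: "J - 1 + p \<le> q" "q \<le> ?N"
      and C: "C \<in> carrier_mat ?N q" "vec_space.rank ?N C = q"
      and Z': "Z' = (\<lambda>x. complete_design J p x * C)"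
      unfolding design_matrices_def by blast
    \<comment> \<open>Here the cumulative partner uses \<open>?M * C\<close>, whose rank is
      preserved because \<open>L\<close> is a left inverse of \<open>?M\<close>.\<close>
    show ?thesis
      using equal_models_sym[OF equal_models_cumulative_sequential[OF assms(3) C(1)]]
        design_matrices_mult_left[OF q C partial_sum_mat_carrier L(1,2)] Z' by auto
  qed
  ultimately show ?thesis
    unfolding equal_model_sets_def by blast
qed

end
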